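(* Let $(A,|)$ be a Sheffer groupoid. Define a unary operation $'$ on $A$ and a binary relation $R$ on $A$ by $x':=x|x$ for all $x\in A$ and $R:=\{(x,y)\in A^2\mid x'|y'=y\}$. Then $(A,R,{}')$ is a directed relational system with involution.
   Context: A Sheffer groupoid is a pair $(A,|)$ where $A$ is a non-empty set and $|$ is a binary operation on $A$ satisfying, for all $x,y\in A$, $(x|y)|(x|x)=x$ and $(x|y)|(y|y)=y$. For a binary relation $R$ on a non-empty set $A$ and $a,b\in A$, let $U(a,b):=\{x\in A\mid (a,x),(b,x)\in R\}$ and $L(a,b):=\{x\in A\mid (x,a),(x,b)\in R\}$. A directed relational system with involution is a triple $(A,R,{}')$ where $A$ is a non-empty set, $R$ is a reflexive binary relation on $A$, $U(x,y)\neq\emptyset$ and $L(x,y)\neq\emptyset$ for all $x,y\in A$, and $'$ is a unary operation on $A$ such that $x''=x$ for all $x\in A$ and $(x,y)\in R$ implies $(y',x')\in R$ for all $x,y\in A$. *)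

theory Defs
  imports Main
begin

locale sheffer_groupoid =
  fixes A :: "'a set" and stroke :: "'a \<Rightarrow> 'a \<Rightarrow> 'a"
  assumes nonempty: "A \<noteq> {}"
    and stroke_closed: "\<And>x y. x \<in> A \<Longrightarrow> y \<in> A \<Longrightarrow> stroke x y \<in> A"
    and stroke_left: "\<And>x y. x \<in> A \<Longrightarrow> y \<in> A \<Longrightarrow> stroke (stroke x y) (stroke x x) = x"
    and stroke_right: "\<And>x y. x \<in> A \<Longrightarrow> y \<in> A \<Longrightarrow> stroke (stroke x y) (stroke y y) = y"

definition upper_cone :: "'a set \<Rightarrow> 'a rel \<Rightarrow> 'a \<Rightarrow> 'a \<Rightarrow> 'a set" where
  "upper_cone A R a b = {x \<in> A. (a, x) \<in> R \<and> (b, x) \<in> R}"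

definition lower_cone :: "'a set \<Rightarrow> 'a rel \<Rightarrow> 'a \<Rightarrow> 'a \<Rightarrow> 'a set" where
  "lower_cone A R a b = {x \<in> A. (x, a) \<in> R \<and> (x, b) \<in> R}"

locale directed_relational_system_with_involution =
  fixes A :: "'a set" and R :: "'a rel" and invol :: "'a \<Rightarrow> 'a"
  assumes nonempty: "A \<noteq> {}"
    and rel_on: "R \<subseteq> A \<times> A"
    and refl_rel: "refl_on A R"
    and upper_cone_nonempty: "\<And>x y. x \<in> A \<Longrightarrow> y \<in> A \<Longrightarrow> upper_cone A R x y \<noteq> {}"
    and lower_cone_nonempty: "\<And>x y. x \<in> A \<Longrightarrow> y \<in> A \<Longrightarrow> lower_cone A R x y \<noteq> {}"
    and invol_closed: "\<And>x. x \<in> A \<Longrightarrow> invol x \<in> A"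
    and invol_invol: "\<And>x. x \<in> A \<Longrightarrow> invol (invol x) = x"
    and invol_antitone: "\<And>x y. x \<in> A \<Longrightarrow> y \<in> A \<Longrightarrow> (x, y) \<in> R \<Longrightarrow> (invol y, invol x) \<in> R"

definition sheffer_compl :: "('a \<Rightarrow> 'a \<Rightarrow> 'a) \<Rightarrow> 'a \<Rightarrow> 'a" where
  "sheffer_compl stroke x = stroke x x"

definition sheffer_rel :: "'a set \<Rightarrow> ('a \<Rightarrow> 'a \<Rightarrow> 'a) \<Rightarrow> 'a rel" where
  "sheffer_rel A stroke =
    {(x, y) \<in> A \<times> A. stroke (sheffer_compl stroke x) (sheffer_compl stroke y) = y}"

end

theory Submission
  imports Defs
begin

text \<open>
  Write \<open>x' = x | x\<close>. Putting \<open>y = x\<close> in the first Sheffer identity gives \<open>x'' = x\<close>, which is also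
  reflexivity of the relation, since \<open>x R x\<close> says \<open>x' | x' = x\<close>. In view of \<open>x'' = x\<close>, the identities
  \<open>(x | y) | x' = x\<close> and \<open>(x | y) | y' = y\<close> say that \<open>(x | y)'\<close> lies below both \<open>x\<close> and \<open>y\<close>; so the
  stroke plays the role of a negated meet, and lower cones are non-empty. If \<open>x R y\<close>, then
  \<open>y = x' | y'\<close>, so \<open>y | x = (x' | y') | x'' = x'\<close>, again by the first identity; this is \<open>y' R x'\<close>.
  Applying the antitone involution to a lower bound of \<open>x'\<close> and \<open>y'\<close> yields an upper bound of
  \<open>x\<close> and \<open>y\<close>.
\<close>

context sheffer_groupoid
begin

lemma sheffer_compl_closed:
  "x \<in> A \<Longrightarrow> sheffer_compl stroke x \<in> A"
  by (simp add: sheffer_compl_def stroke_closed)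

lemma sheffer_compl_invol:
  "x \<in> A \<Longrightarrow> sheffer_compl stroke (sheffer_compl stroke x) = x"
  by (simp add: sheffer_compl_def stroke_left)

lemma sheffer_rel_refl:
  "x \<in> A \<Longrightarrow> (x, x) \<in> sheffer_rel A stroke"
  by (simp add: sheffer_rel_def sheffer_compl_def stroke_left)

text \<open>
  Once the double complement on the left argument is cancelled, the two comparisons are
  the two Sheffer identities themselves.
\<close>

lemma compl_stroke_below:
  assumes "x \<in> A" and "y \<in> A"
  shows "(sheffer_compl stroke (stroke x y), x) \<in> sheffer_rel A stroke"
    and "(sheffer_compl stroke (stroke x y), y) \<in> sheffer_rel A stroke"
proof -
  have xy: "stroke x y \<in> A"
    using assms by (rule stroke_closed)
  have "stroke (stroke x y) (sheffer_compl stroke x) = x"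
    and "stroke (stroke x y) (sheffer_compl stroke y) = y"
    using assms by (simp_all add: sheffer_compl_def stroke_left stroke_right)
  then show "(sheffer_compl stroke (stroke x y), x) \<in> sheffer_rel A stroke"
    and "(sheffer_compl stroke (stroke x y), y) \<in> sheffer_rel A stroke"
    using assms xy
    by (simp_all add: sheffer_rel_def sheffer_compl_invol sheffer_compl_closed)
qed

text \<open>
  The first Sheffer identity, taken at \<open>x'\<close> and \<open>y'\<close>, determines \<open>y | x\<close> because
  the hypothesis lets \<open>y\<close> be rewritten as \<open>x' | y'\<close>.
\<close>

lemma sheffer_compl_antitone:
  assumes "(x, y) \<in> sheffer_rel A stroke"
  shows "(sheffer_compl stroke y, sheffer_compl stroke x) \<in> sheffer_rel A stroke"
proof -
  let ?x' = "sheffer_compl stroke x" and ?y' = "sheffer_compl stroke y"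
  have x: "x \<in> A" and y: "y \<in> A" and xy: "stroke ?x' ?y' = y"
    using assms by (auto simp: sheffer_rel_def)
  have "stroke (stroke ?x' ?y') (stroke ?x' ?x') = ?x'"
    using x y by (intro stroke_left sheffer_compl_closed)
  moreover have "stroke ?x' ?x' = x"
    using sheffer_compl_invol[OF x] by (simp add: sheffer_compl_def)
  ultimately have "stroke y x = ?x'"
    using xy by simp
  then show ?thesis
    using x y by (simp add: sheffer_rel_def sheffer_compl_invol sheffer_compl_closed)
qed

text \<open>Dual, under the involution, to the lower bounds given by \<open>(x | y)'\<close>.\<close>

lemma stroke_compl_above:
  assumes "x \<in> A" and "y \<in> A"
  shows "(x, stroke (sheffer_compl stroke x) (sheffer_compl stroke y)) \<in> sheffer_rel A stroke"
    and "(y, stroke (sheffer_compl stroke x) (sheffer_compl stroke y)) \<in> sheffer_rel A stroke"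
  using compl_stroke_below[of "sheffer_compl stroke x" "sheffer_compl stroke y",
      THEN sheffer_compl_antitone] assms
  by (simp_all add: sheffer_compl_invol sheffer_compl_closed stroke_closed)

end

theorem theorem3p1:
  fixes A :: "'a set" and stroke :: "'a \<Rightarrow> 'a \<Rightarrow> 'a"
  assumes "sheffer_groupoid A stroke"
  shows "directed_relational_system_with_involution A (sheffer_rel A stroke) (sheffer_compl stroke)"
proof -
  interpret sheffer_groupoid A stroke by (fact assms)
  show ?thesis
  proof
    show "A \<noteq> {}" by (fact nonempty)
    show rel_on: "sheffer_rel A stroke \<subseteq> A \<times> A"
      by (auto simp: sheffer_rel_def)
    show "refl_on A (sheffer_rel A stroke)"
      using rel_on sheffer_rel_refl by (auto simp: refl_on_def)
  next
    fix x y
    assume x: "x \<in> A" and y: "y \<in> A"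
    show "upper_cone A (sheffer_rel A stroke) x y \<noteq> {}"
      using stroke_compl_above[OF x y] by (auto simp: upper_cone_def sheffer_rel_def)
    show "lower_cone A (sheffer_rel A stroke) x y \<noteq> {}"
      using compl_stroke_below[OF x y] by (auto simp: lower_cone_def sheffer_rel_def)
  qed (auto intro: sheffer_compl_closed sheffer_compl_invol sheffer_compl_antitone)
qed

end
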